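(* For any integer $k\ge1$, $$\sum_{\pi\in\mathcal{DS}^k}x^{|\pi_o|}y^{|\pi_e|}\prod_{l=1}^{k-1}u_l^{o_l(\pi)}v_l^{e_l(\pi)}=\frac{\Big(-\sum_{l=1}^{k-1}u_lx^l,\;-x^k\sum_{l=1}^{k-1}v_ly^l;\;x^ky^k\Big)_\infty}{(x^k;x^ky^k)_\infty}.$$
   Context: A partition is $k$-strict if for every $m\in\mathbb{N}$ and all $1\le r_1\le r_2\le k-1$, the numbers $mk+r_1$ and $mk+r_2$ do not appear together as parts. $\mathcal{DS}^k$ is the set of $k$-strict partitions into distinct parts. For a partition $\pi=(\pi_1\ge\pi_2\ge\cdots)$, $|\pi_o|$ (resp. $|\pi_e|$) is the sum of its odd-indexed parts $\pi_1,\pi_3,\dots$ (resp. even-indexed parts $\pi_2,\pi_4,\dots$), and for $1\le l\le k-1$, $o_l(\pi)$ (resp. $e_l(\pi)$) is the number of odd-indexed (resp. even-indexed) parts that are $\equiv l\pmod k$. $(a,b;q)_\infty=\prod_{i\ge1}(1-aq^{i-1})(1-bq^{i-1})$. *)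

theory Defs
  imports "HOL-Analysis.Analysis"
begin

text \<open>
  A partition is the weakly decreasing list of its (positive) parts; the empty list is the
  partition of 0.
\<close>
definition is_partition :: "nat list \<Rightarrow> bool" where
  "is_partition p \<longleftrightarrow> sorted_wrt (\<ge>) p \<and> (\<forall>n\<in>set p. n > 0)"

text \<open>
  ``Appear together as parts'' refers to two different positions of the partition, so the case
  \<open>r1 = r2\<close> says that a part not divisible by \<open>k\<close> is not repeated.
\<close>
definition k_strict :: "nat \<Rightarrow> nat list \<Rightarrow> bool" where
  "k_strict k p \<longleftrightarrow>
     (\<forall>m r1 r2. 1 \<le> r1 \<and> r1 \<le> r2 \<and> r2 \<le> k - 1 \<longrightarrow>
        \<not> (\<exists>i j. i < length p \<and> j < length p \<and> i \<noteq> j \<and>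
               p ! i = m * k + r1 \<and> p ! j = m * k + r2))"

definition DS :: "nat \<Rightarrow> nat list set" where
  "DS k = {p. is_partition p \<and> k_strict k p \<and> distinct p}"

text \<open>
  List positions start at 0, so the odd-indexed parts \<open>\<pi>\<^sub>1, \<pi>\<^sub>3, \<dots>\<close> are those at even positions.
\<close>
definition odd_indexed :: "nat list \<Rightarrow> nat list" where
  "odd_indexed p = nths p {i. even i}"

definition even_indexed :: "nat list \<Rightarrow> nat list" where
  "even_indexed p = nths p {i. odd i}"

definition count_residue :: "nat \<Rightarrow> nat \<Rightarrow> nat list \<Rightarrow> nat" where
  "count_residue k l ns = length (filter (\<lambda>n. n mod k = l mod k) ns)"

text \<open>
  The infinite q-Pochhammer symbol \<open>(a\<^sub>1, \<dots>, a\<^sub>r; q)\<^sub>\<infinity>\<close>; the product index is shifted to start at 0.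
\<close>
definition qpochhammer_inf :: "complex list \<Rightarrow> complex \<Rightarrow> complex" where
  "qpochhammer_inf as q = (\<Prod>i. \<Prod>a\<leftarrow>as. 1 - a * q ^ i)"

end

theory Submission
  imports Defs
begin

text \<open>
  Build a partition from its largest part downwards, one block of parts \<open>N k + 1, \<dots>, N k + k\<close> at a
  time. Prepending a part interchanges the odd- and even-indexed parts, so the generating function
  \<open>P\<^sub>N\<close> of the partitions with parts at most \<open>N k\<close> satisfies a recurrence that couples it to its mirror
  image \<open>Q\<^sub>N\<close> (swap \<open>x\<close> with \<open>y\<close> and \<open>u\<close> with \<open>v\<close>). With \<open>X = x\<^sup>k\<close>, \<open>Y = y\<^sup>k\<close>, \<open>q = X Y\<close>,
  \<open>A = \<Sum>l. u\<^sub>l x\<^sup>l\<close> and \<open>B = \<Sum>l. v\<^sub>l y\<^sup>l\<close>, its solution is a two-parameter Rogers-Szego polynomial,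
  \<open>P\<^sub>N = \<Sum>j\<le>N. [N, j]\<^sub>q (-A; q)\<^bsub>N-j\<^esub> (-B; q)\<^sub>j X\<^sup>j\<close>. Letting \<open>N\<close> tend to infinity and summing by the
  q-binomial theorem gives the product. The same formula evaluated at the norms of the variables
  bounds the partial sums, which yields absolute convergence.
\<close>

subsection \<open>The q-binomial theorem\<close>

definition qpochhammer :: "complex \<Rightarrow> complex \<Rightarrow> nat \<Rightarrow> complex" where
  "qpochhammer a q n = (\<Prod>i<n. 1 - a * q ^ i)"

lemma qpochhammer_0 [simp]: "qpochhammer a q 0 = 1"
  by (simp add: qpochhammer_def)

lemma qpochhammer_Suc: "qpochhammer a q (Suc n) = qpochhammer a q n * (1 - a * q ^ n)"
  by (simp add: qpochhammer_def)

lemma one_minus_qpow_nonzero: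
  fixes a q :: complex
  assumes "norm q < 1" "norm a < 1"
  shows "1 - a * q ^ n \<noteq> 0"
proof
  assume "1 - a * q ^ n = 0"
  then have "norm (a * q ^ n) = 1"
    by (metis eq_iff_diff_eq_0 norm_one)
  moreover have "norm (a * q ^ n) \<le> norm a * 1"
    unfolding norm_mult norm_power using assms
    by (intro mult_left_mono power_le_one) auto
  ultimately show False
    using assms by simp
qed

lemma qpochhammer_nonzero:
  assumes "norm q < 1" "norm a < 1"
  shows "qpochhammer a q n \<noteq> 0"
  using one_minus_qpow_nonzero[OF assms] by (simp add: qpochhammer_def)

lemma convergent_prod_qpochhammer:
  fixes a q :: complex
  assumes "norm q < 1"
  shows "convergent_prod (\<lambda>i. 1 - a * q ^ i)"
proof (intro abs_convergent_prod_imp_convergent_prod summable_imp_abs_convergent_prod)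
  show "summable (\<lambda>i. norm (1 - a * q ^ i - 1))"
    using assms by (simp add: norm_mult norm_power summable_mult)
qed

lemma qpochhammer_inf_single: "qpochhammer_inf [a] q = (\<Prod>i. 1 - a * q ^ i)"
  by (simp add: qpochhammer_inf_def)

lemma qpochhammer_inf_pair:
  assumes "norm q < 1"
  shows "qpochhammer_inf [a, b] q = qpochhammer_inf [a] q * qpochhammer_inf [b] q"
  by (simp add: qpochhammer_inf_def prodinf_mult convergent_prod_qpochhammer[OF assms])

lemma qpochhammer_tendsto:
  assumes "norm q < 1"
  shows "qpochhammer a q \<longlonglongrightarrow> qpochhammer_inf [a] q"
proof -
  have "(\<lambda>n. qpochhammer a q (Suc n)) \<longlonglongrightarrow> qpochhammer_inf [a] q"
    using convergent_prod_LIMSEQ[OF convergent_prod_qpochhammer[OF assms, of a]]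
    by (simp add: qpochhammer_def qpochhammer_inf_single lessThan_Suc_atMost del: prod.lessThan_Suc)
  then show ?thesis
    by (rule LIMSEQ_imp_Suc)
qed

lemma qpochhammer_inf_nonzero:
  assumes "norm q < 1" "norm a < 1"
  shows "qpochhammer_inf [a] q \<noteq> 0"
  unfolding qpochhammer_inf_single
  using convergent_prod_qpochhammer[OF assms(1)] one_minus_qpow_nonzero[OF assms]
  by (intro prodinf_nonzero) auto

text \<open>The coefficient of z^n in the q-binomial series. Since [N, j]_q = (q;q)_N / ((q;q)_{N-j}
  (q;q)_j), Gaussian binomials can be absorbed into products of two such coefficients.\<close>

definition qbinom_coeff :: "complex \<Rightarrow> complex \<Rightarrow> nat \<Rightarrow> complex" where
  "qbinom_coeff a q n = qpochhammer a q n / qpochhammer q q n"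

lemma qbinom_coeff_0 [simp]: "qbinom_coeff a q 0 = 1"
  by (simp add: qbinom_coeff_def)

text \<open>Kept free of division, because the factor 1 - q^n arises by itself both in the
  functional equation of the series and in the q-Pascal splitting.\<close>

lemma qbinom_coeff_Suc:
  assumes "norm q < 1"
  shows "(1 - q ^ Suc n) * qbinom_coeff a q (Suc n) = (1 - a * q ^ n) * qbinom_coeff a q n"
  using qpochhammer_nonzero[OF assms assms, of n] one_minus_qpow_nonzero[OF assms assms, of n]
  by (simp add: qbinom_coeff_def qpochhammer_Suc field_simps)

lemma qbinom_coeff_tendsto:
  assumes "norm q < 1"
  shows "qbinom_coeff a q \<longlonglongrightarrow> qpochhammer_inf [a] q / qpochhammer_inf [q] q"
  unfolding qbinom_coeff_def
  by (intro tendsto_divide qpochhammer_tendsto qpochhammer_inf_nonzero assms)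

lemma qbinom_coeff_bounded:
  assumes "norm q < 1"
  obtains K where "\<And>n. norm (qbinom_coeff a q n) \<le> K"
  using convergent_imp_Bseq[OF convergentI[OF qbinom_coeff_tendsto[OF assms, of a]]]
  unfolding Bseq_def by blast

lemma summable_qbinom:
  assumes "norm q < 1" "norm z < 1"
  shows "summable (\<lambda>n. norm (qbinom_coeff a q n * z ^ n))"
proof -
  obtain K where K: "\<And>n. norm (qbinom_coeff a q n) \<le> K"
    using qbinom_coeff_bounded[OF assms(1)] by metis
  show ?thesis
  proof (rule summable_comparison_test')
    show "summable (\<lambda>n. K * norm z ^ n)"
      using assms by (intro summable_mult) simp
    show "norm (norm (qbinom_coeff a q n * z ^ n)) \<le> K * norm z ^ n" if "n \<ge> 0" for n
      using K[of n] by (simp add: norm_mult norm_power mult_right_mono)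
  qed
qed

text \<open>
  Comparing coefficients gives \<open>(1 - z) f(z) = (1 - a z) f(q z)\<close> for the series \<open>f\<close> on the left;
  iterate and use \<open>f(q\<^sup>n z) \<longlonglongrightarrow> f(0) = 1\<close>.
\<close>
theorem q_binomial_theorem:
  assumes q: "norm q < 1" and z: "norm z < 1"
  shows "(\<Sum>n. qbinom_coeff a q n * z ^ n) = qpochhammer_inf [a * z] q / qpochhammer_inf [z] q"
proof -
  define t where "t = qbinom_coeff a q"
  define f where "f = (\<lambda>w. \<Sum>n. t n * w ^ n)"
  have sm: "summable (\<lambda>n. t n * w ^ n)" if "norm w < 1" for w
    using summable_norm_cancel[OF summable_qbinom[OF q that]] by (simp add: t_def)
  have step: "(1 - w) * f w = (1 - a * w) * f (q * w)" if w: "norm w < 1" for w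
  proof -
    have qw: "norm (q * w) < 1"
      using q w by (metis mult_less_cancel_left2 mult_zero_right norm_ge_zero norm_mult order_le_less
          order_less_le_trans less_trans mult.commute)
    have "f w - f (q * w) = (\<Sum>n. t n * w ^ n - t n * (q * w) ^ n)"
      unfolding f_def by (rule suminf_diff[OF sm[OF w] sm[OF qw]])
    \<comment> \<open>The terms at n = 0 cancel, so the coefficient recurrence applies to everything
      that remains.\<close>
    also have "\<dots> = (\<Sum>n. t (Suc n) * w ^ Suc n - t (Suc n) * (q * w) ^ Suc n)"
      by (subst suminf_split_head[OF summable_diff[OF sm[OF w] sm[OF qw]]]) simp
    also have "\<dots> = (\<Sum>n. w * (t n * w ^ n) - a * w * (t n * (q * w) ^ n))"
    proof (rule suminf_cong)
      fix n
      have "t (Suc n) * w ^ Suc n - t (Suc n) * (q * w) ^ Suc n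
          = w ^ Suc n * ((1 - q ^ Suc n) * t (Suc n))"
        by (simp add: algebra_simps power_mult_distrib)
      also have "\<dots> = w ^ Suc n * ((1 - a * q ^ n) * t n)"
        unfolding t_def qbinom_coeff_Suc[OF q] ..
      finally show "t (Suc n) * w ^ Suc n - t (Suc n) * (q * w) ^ Suc n
          = w * (t n * w ^ n) - a * w * (t n * (q * w) ^ n)"
        by (simp add: algebra_simps power_mult_distrib)
    qed
    also have "\<dots> = w * f w - a * w * f (q * w)"
      unfolding f_def using sm[OF w] sm[OF qw]
      by (simp add: suminf_diff[symmetric] suminf_mult[symmetric] summable_mult)
    finally show ?thesis
      by (simp add: algebra_simps)
  qed
  have iter: "qpochhammer z q n * f z = qpochhammer (a * z) q n * f (q ^ n * z)" for n
  proof (induction n)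
    case (Suc n)
    have "norm (q ^ n * z) \<le> 1 * norm z"
      unfolding norm_mult norm_power using q by (intro mult_right_mono power_le_one) auto
    then have "norm (q ^ n * z) < 1"
      using z by simp
    from step[OF this] have "(1 - z * q ^ n) * f (q ^ n * z) = (1 - a * z * q ^ n) * f (q ^ Suc n * z)"
      by (simp add: mult_ac)
    note step' = this
    have "qpochhammer z q (Suc n) * f z = (1 - z * q ^ n) * (qpochhammer z q n * f z)"
      by (simp only: qpochhammer_Suc mult_ac)
    also have "\<dots> = qpochhammer (a * z) q n * ((1 - z * q ^ n) * f (q ^ n * z))"
      unfolding Suc by (simp only: mult_ac)
    also have "\<dots> = qpochhammer (a * z) q (Suc n) * f (q ^ Suc n * z)"
      unfolding step' qpochhammer_Suc by (simp only: mult.assoc)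
    finally show ?case .
  qed simp
  \<comment> \<open>A power series is continuous at 0 once it converges at some nonzero point; 1/2
    is merely one in the unit disc.\<close>
  have "isCont f 0"
    unfolding f_def by (rule isCont_powser[where K = "1/2"]) (auto intro: sm simp: norm_divide)
  moreover have "(\<lambda>n. q ^ n * z) \<longlonglongrightarrow> 0"
    using LIMSEQ_power_zero[OF q] by (rule tendsto_mult_left_zero)
  ultimately have "(\<lambda>n. f (q ^ n * z)) \<longlonglongrightarrow> f 0"
    by (rule isCont_tendsto_compose)
  moreover have "f 0 = 1"
    unfolding f_def using powser_zero[of t] by (simp add: t_def)
  ultimately have "(\<lambda>n. qpochhammer z q n * f z) \<longlonglongrightarrow> qpochhammer_inf [a * z] q * 1"
    unfolding iter by (intro tendsto_mult qpochhammer_tendsto q) simp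
  moreover have "(\<lambda>n. qpochhammer z q n * f z) \<longlonglongrightarrow> qpochhammer_inf [z] q * f z"
    by (intro tendsto_intros qpochhammer_tendsto q)
  ultimately have "qpochhammer_inf [z] q * f z = qpochhammer_inf [a * z] q"
    using LIMSEQ_unique by fastforce
  then show ?thesis
    using qpochhammer_inf_nonzero[OF q z] by (simp add: f_def t_def field_simps)
qed

text \<open>Dominated convergence for series (Tannery): for fixed j the factor s (N - j) tends to L,
  and boundedness of s supplies the summable majorant K |t j|.\<close>

lemma convolution_tendsto:
  fixes s t :: "nat \<Rightarrow> complex"
  assumes s: "s \<longlonglongrightarrow> L" and t: "summable (\<lambda>n. norm (t n))"
  shows "(\<lambda>N. \<Sum>j\<le>N. s (N - j) * t j) \<longlonglongrightarrow> L * suminf t"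
proof -
  obtain K where K: "\<And>n. norm (s n) \<le> K"
    using convergent_imp_Bseq[OF convergentI[OF s]] unfolding Bseq_def by blast
  \<comment> \<open>Padding with zeros turns sums of varying length into series over all j and hides
    the truncated subtraction.\<close>
  define g where "g = (\<lambda>j N. if j \<le> N then s (N - j) * t j else 0)"
  have K0: "0 \<le> K"
    using K[of 0] norm_ge_zero order_trans by blast
  have "(\<lambda>N. suminf (\<lambda>j. g j N)) \<longlonglongrightarrow> suminf (\<lambda>j. L * t j)"
  proof (rule tannerys_theorem[THEN conjunct2, THEN conjunct2])
    fix j
    have "(\<lambda>N. s (N - j) * t j) \<longlonglongrightarrow> L * t j"
      by (intro tendsto_intros filterlim_compose[OF s] filterlim_minus_const_nat_at_top)
    then show "g j \<longlonglongrightarrow> L * t j"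
      by (rule Lim_transform_eventually)
        (use eventually_ge_at_top[of j] in eventually_elim, simp add: g_def)
    show "summable (\<lambda>j. K * norm (t j))"
      using t by (rule summable_mult)
    show "\<forall>\<^sub>F (j, N) in sequentially \<times>\<^sub>F sequentially. norm (g j N) \<le> K * norm (t j)"
      using K K0 by (intro always_eventually) (auto simp: g_def norm_mult mult_right_mono)
  qed simp
  moreover have "suminf (\<lambda>j. g j N) = (\<Sum>j\<le>N. s (N - j) * t j)" for N
    by (subst suminf_finite[of "{..N}"]) (auto simp: g_def)
  moreover have "suminf (\<lambda>j. L * t j) = L * suminf t"
    using summable_norm_cancel[OF t] by (rule suminf_mult)
  ultimately show ?thesis
    by simp
qed

subsection \<open>Rogers-Szego polynomials\<close>

text \<open>
  In terms of Gaussian binomials this is \<open>\<Sum>j\<le>N. [N, j]\<^sub>q (a; q)\<^bsub>N-j\<^esub> (b; q)\<^sub>j X\<^sup>j\<close>, a two-parameter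
  Rogers-Szego polynomial.
\<close>
definition rogers_szego :: "nat \<Rightarrow> complex \<Rightarrow> complex \<Rightarrow> complex \<Rightarrow> complex \<Rightarrow> complex" where
  "rogers_szego N a b X q =
     qpochhammer q q N * (\<Sum>j\<le>N. qbinom_coeff a q (N - j) * qbinom_coeff b q j * X ^ j)"

lemma rogers_szego_0 [simp]: "rogers_szego 0 a b X q = 1"
  by (simp add: rogers_szego_def)

text \<open>The sum is a convolution of a convergent sequence with a summable one. The prefactor
  (q;q)_N cancels the denominator of the limit of \<open>qbinom_coeff a q\<close>, and the
  q-binomial theorem evaluates the series in b.\<close>

lemma rogers_szego_tendsto:
  assumes q: "norm q < 1" and X: "norm X < 1"
  shows "(\<lambda>N. rogers_szego N a b X q) \<longlonglongrightarrow> qpochhammer_inf [a, b * X] q / qpochhammer_inf [X] q"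
proof -
  have "(\<lambda>N. rogers_szego N a b X q) \<longlonglongrightarrow> qpochhammer_inf [q] q *
      (qpochhammer_inf [a] q / qpochhammer_inf [q] q * (\<Sum>n. qbinom_coeff b q n * X ^ n))"
    unfolding rogers_szego_def mult.assoc
    by (intro tendsto_mult qpochhammer_tendsto convolution_tendsto qbinom_coeff_tendsto
        summable_qbinom q X)
  then show ?thesis
    using qpochhammer_inf_nonzero[OF q q] q X
    by (simp add: q_binomial_theorem qpochhammer_inf_pair)
qed

text \<open>Reversing the summation and distributing X^N expresses the mirror polynomial through the
  same summands as the original one, each with an extra factor q^(N-j), where q = X Y.\<close>

lemma rogers_szego_swap:
  "X ^ N * rogers_szego N b a Y (X * Y) =
   qpochhammer (X * Y) (X * Y) N *
     (\<Sum>j\<le>N. qbinom_coeff a (X * Y) (N - j) * qbinom_coeff b (X * Y) j * X ^ j * (X * Y) ^ (N - j))"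
proof -
  have "X ^ N * (\<Sum>j\<le>N. qbinom_coeff b (X * Y) (N - j) * qbinom_coeff a (X * Y) j * Y ^ j) =
      (\<Sum>j\<le>N. qbinom_coeff a (X * Y) (N - j) * qbinom_coeff b (X * Y) j * (X ^ N * Y ^ (N - j)))"
    unfolding sum_distrib_left
    by (subst sum.nat_diff_reindex[symmetric, of _ "Suc N", simplified lessThan_Suc_atMost])
      (auto intro!: sum.cong simp: algebra_simps)
  also have "\<dots> = (\<Sum>j\<le>N. qbinom_coeff a (X * Y) (N - j) * qbinom_coeff b (X * Y) j *
      X ^ j * (X * Y) ^ (N - j))"
  proof (rule sum.cong[OF refl])
    fix j assume "j \<in> {..N}"
    then have "X ^ N = X ^ j * X ^ (N - j)"
      by (simp flip: power_add)
    then show "qbinom_coeff a (X * Y) (N - j) * qbinom_coeff b (X * Y) j * (X ^ N * Y ^ (N - j)) =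
        qbinom_coeff a (X * Y) (N - j) * qbinom_coeff b (X * Y) j * X ^ j * (X * Y) ^ (N - j)"
      by (simp add: power_mult_distrib)
  qed
  finally show ?thesis
    unfolding rogers_szego_def by (simp add: mult.left_commute)
qed

text \<open>This is the recurrence that the partition sums satisfy. The q-Pascal splitting lowers
  one of the two indices in each summand, and the terms with an extra q^(N-j) assemble into the
  mirror polynomial.\<close>

lemma rogers_szego_Suc:
  assumes q: "norm (X * Y) < 1"
  shows "rogers_szego (Suc N) a b X (X * Y) =
    (1 - b * X * (X * Y) ^ N) * rogers_szego N a b X (X * Y) +
    (X - a) * (X ^ N * rogers_szego N b a Y (X * Y))"
proof -
  define q where "q = X * Y"
  define s where "s = qbinom_coeff a q"
  define t where "t = qbinom_coeff b q"
  note q' = assms[folded q_def]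
  have s: "(1 - q ^ Suc n) * s (Suc n) = (1 - a * q ^ n) * s n"
    and t: "(1 - q ^ Suc n) * t (Suc n) = (1 - b * q ^ n) * t n" for n
    unfolding s_def t_def by (rule qbinom_coeff_Suc[OF q'])+
  \<comment> \<open>This splitting is the q-Pascal rule.\<close>
  have split: "1 - q ^ Suc N = (1 - q ^ (Suc N - j)) + q ^ (Suc N - j) * (1 - q ^ j)"
    if "j \<le> Suc N" for j
    using that by (simp add: algebra_simps flip: power_add)
  have "(1 - q ^ Suc N) * (\<Sum>j\<le>Suc N. s (Suc N - j) * t j * X ^ j) =
      (\<Sum>j\<le>Suc N. (1 - q ^ (Suc N - j)) * s (Suc N - j) * t j * X ^ j) +
      (\<Sum>j\<le>Suc N. q ^ (Suc N - j) * s (Suc N - j) * ((1 - q ^ j) * t j) * X ^ j)"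
    unfolding sum_distrib_left sum.distrib[symmetric]
  proof (rule sum.cong[OF refl])
    fix j assume "j \<in> {..Suc N}"
    then have "j \<le> Suc N" by simp
    from split[OF this]
    show "(1 - q ^ Suc N) * (s (Suc N - j) * t j * X ^ j) =
        (1 - q ^ (Suc N - j)) * s (Suc N - j) * t j * X ^ j +
        q ^ (Suc N - j) * s (Suc N - j) * ((1 - q ^ j) * t j) * X ^ j"
      by (simp only:) (simp add: algebra_simps)
  qed
  \<comment> \<open>The factor 1 - q^0 kills the term j = N + 1 here, and the term j = 0 in the
    second sum, whose index is then shifted.\<close>
  also have "(\<Sum>j\<le>Suc N. (1 - q ^ (Suc N - j)) * s (Suc N - j) * t j * X ^ j) =
      (\<Sum>j\<le>N. (1 - a * q ^ (N - j)) * s (N - j) * t j * X ^ j)"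
    by (auto simp: Suc_diff_le s simp del: power_Suc intro!: sum.cong)
  also have "(\<Sum>j\<le>Suc N. q ^ (Suc N - j) * s (Suc N - j) * ((1 - q ^ j) * t j) * X ^ j) =
      (\<Sum>j\<le>N. q ^ (N - j) * s (N - j) * ((1 - b * q ^ j) * t j) * X ^ Suc j)"
    by (subst sum.atMost_Suc_shift) (simp add: t del: power_Suc)
  \<comment> \<open>Termwise, (1 - a q^(N-j)) + X q^(N-j) (1 - b q^j) = (1 - b X q^N) + (X - a)
    q^(N-j).\<close>
  also have "(\<Sum>j\<le>N. (1 - a * q ^ (N - j)) * s (N - j) * t j * X ^ j) + \<dots> =
      (\<Sum>j\<le>N. (1 - b * X * q ^ N) * (s (N - j) * t j * X ^ j) +
        (X - a) * (s (N - j) * t j * X ^ j * q ^ (N - j)))"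
    unfolding sum.distrib[symmetric]
  proof (rule sum.cong[OF refl])
    fix j assume "j \<in> {..N}"
    then have *: "q ^ N = q ^ (N - j) * q ^ j"
      by (simp flip: power_add)
    show "(1 - a * q ^ (N - j)) * s (N - j) * t j * X ^ j +
        q ^ (N - j) * s (N - j) * ((1 - b * q ^ j) * t j) * X ^ Suc j =
        (1 - b * X * q ^ N) * (s (N - j) * t j * X ^ j) +
        (X - a) * (s (N - j) * t j * X ^ j * q ^ (N - j))"
      unfolding * by (simp add: algebra_simps)
  qed
  also have "\<dots> = (1 - b * X * q ^ N) * (\<Sum>j\<le>N. s (N - j) * t j * X ^ j) +
      (X - a) * (\<Sum>j\<le>N. s (N - j) * t j * X ^ j * q ^ (N - j))"
    by (simp add: sum.distrib sum_distrib_left)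
  finally have eq: "(1 - q ^ Suc N) * (\<Sum>j\<le>Suc N. s (Suc N - j) * t j * X ^ j) = \<dots>" .
  have "rogers_szego (Suc N) a b X q =
      qpochhammer q q N * ((1 - q ^ Suc N) * (\<Sum>j\<le>Suc N. s (Suc N - j) * t j * X ^ j))"
    unfolding rogers_szego_def s_def[symmetric] t_def[symmetric] qpochhammer_Suc
    by (simp only: mult.assoc power_Suc)
  then have "rogers_szego (Suc N) a b X q =
      qpochhammer q q N * ((1 - b * X * q ^ N) * (\<Sum>j\<le>N. s (N - j) * t j * X ^ j) +
      (X - a) * (\<Sum>j\<le>N. s (N - j) * t j * X ^ j * q ^ (N - j)))"
    unfolding eq .
  also have "\<dots> = (1 - b * X * q ^ N) * rogers_szego N a b X q +
      (X - a) * (X ^ N * rogers_szego N b a Y q)"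
    unfolding q_def rogers_szego_swap
    unfolding rogers_szego_def q_def[symmetric] s_def[symmetric] t_def[symmetric]
    by (simp only: distrib_left mult.left_commute)
  finally show ?thesis
    by (simp only: q_def)
qed

subsection \<open>Partitions with bounded parts\<close>

text \<open>Equal quotients by k mean membership in the same block, so each block holds at most one
  part not divisible by k. Distinctness lets values replace positions and already excludes the case
  r1 = r2.\<close>

lemma DS_iff:
  assumes k: "k \<ge> 1"
  shows "p \<in> DS k \<longleftrightarrow> sorted_wrt (>) p \<and> 0 \<notin> set p \<and>
     (\<forall>a\<in>set p. \<forall>b\<in>set p. a \<noteq> b \<and> a div k = b div k \<longrightarrow> k dvd a \<or> k dvd b)"
proof -
  have "sorted_wrt (>) p \<longleftrightarrow> sorted_wrt (\<ge>) p \<and> distinct p"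
    by (induction p) (auto simp: less_le)
  moreover have "k_strict k p \<longleftrightarrow>
      (\<forall>a\<in>set p. \<forall>b\<in>set p. a \<noteq> b \<and> a div k = b div k \<longrightarrow> k dvd a \<or> k dvd b)" (is "_ \<longleftrightarrow> ?R")
    if "distinct p"
  proof
    assume L: "k_strict k p"
    \<comment> \<open>The residues are ordered to match r1 and r2 in \<open>k_strict\<close>; the
      other order follows by symmetry.\<close>
    have *: "k dvd a \<or> k dvd b"
      if ab: "a \<in> set p" "b \<in> set p" "a \<noteq> b" "a div k = b div k" "a mod k \<le> b mod k" for a b
    proof (rule ccontr)
      assume no: "\<not> (k dvd a \<or> k dvd b)"
      have "1 \<le> a mod k"
        using no by (simp add: dvd_eq_mod_eq_0 Suc_le_eq)
      moreover have "b mod k \<le> k - 1"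
        using k mod_less_divisor[of k b] by linarith
      moreover obtain i j where "i < length p" "j < length p" "p ! i = a" "p ! j = b"
        using ab by (metis in_set_conv_nth)
      moreover have "a = b div k * k + a mod k" "b = b div k * k + b mod k"
        using ab by (metis div_mult_mod_eq)+
      ultimately show False
        using L ab unfolding k_strict_def by metis
    qed
    show ?R
      using * by (metis nle_le)
  next
    assume R: ?R
    show "k_strict k p"
      unfolding k_strict_def
    proof (intro allI impI notI)
      fix m r1 r2
      assume r: "1 \<le> r1 \<and> r1 \<le> r2 \<and> r2 \<le> k - 1"
      assume "\<exists>i j. i < length p \<and> j < length p \<and> i \<noteq> j \<and> p ! i = m * k + r1 \<and> p ! j = m * k + r2"
      then obtain i j where ij: "i < length p" "j < length p" "i \<noteq> j"
        "p ! i = m * k + r1" "p ! j = m * k + r2"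
        by blast
      then have "p ! i \<noteq> p ! j"
        using \<open>distinct p\<close> by (metis nth_eq_iff_index_eq)
      then have "m * k + r1 \<in> set p" "m * k + r2 \<in> set p" "m * k + r1 \<noteq> m * k + r2"
        using ij nth_mem by metis+
      moreover have "r1 < k" "r2 < k"
        using r by linarith+
      ultimately show False
        using R r by (fastforce simp: dvd_eq_mod_eq_0)
    qed
  qed
  moreover have "(\<forall>n\<in>set p. n > 0) \<longleftrightarrow> 0 \<notin> set p"
    by (metis gr0I less_numeral_extra(3))
  ultimately show ?thesis
    unfolding DS_def is_partition_def by blast
qed

lemma Nil_in_DS [simp]: "[] \<in> DS k"
  by (simp add: DS_def is_partition_def k_strict_def)

lemma DS_Cons_iff:
  assumes "k \<ge> 1"
  shows "n # p \<in> DS k \<longleftrightarrow> p \<in> DS k \<and> n > 0 \<and> (\<forall>b\<in>set p. b < n) \<and>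
     (\<forall>b\<in>set p. n div k = b div k \<longrightarrow> k dvd n \<or> k dvd b)"
  unfolding DS_iff[OF assms] by (auto; metis)

definition DS_le :: "nat \<Rightarrow> nat \<Rightarrow> nat list set" where
  "DS_le k M = {p \<in> DS k. \<forall>n\<in>set p. n \<le> M}"

lemma DS_le_subset: "DS_le k M \<subseteq> DS k"
  by (auto simp: DS_le_def)

lemma DS_le_mono: "M \<le> M' \<Longrightarrow> DS_le k M \<subseteq> DS_le k M'"
  by (force simp: DS_le_def)

lemma finite_DS_le: "finite (DS_le k M)"
proof (rule finite_subset)
  show "DS_le k M \<subseteq> {p. set p \<subseteq> {..M} \<and> distinct p}"
    by (auto simp: DS_le_def DS_def)
qed (rule finite_subset_distinct; simp)

lemma DS_le_0: "DS_le k 0 = {[]}"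
proof -
  have "p = []" if "p \<in> DS_le k 0" for p
    using that by (cases p) (auto simp: DS_le_def DS_def is_partition_def)
  then show ?thesis
    by (auto simp: DS_le_def)
qed

text \<open>Below a largest part N k + r + 1 no other non-multiple of k from the same block may
  occur, so the remaining parts drop to at most N k; the part N k itself stays allowed.\<close>

lemma DS_le_Suc_residue:
  assumes k: "k \<ge> 1" and r: "r < k - 1"
  shows "DS_le k (N * k + Suc r) = DS_le k (N * k + r) \<union> Cons (N * k + Suc r) ` DS_le k (N * k)"
    (is "?L = ?R")
proof (intro equalityI subsetI)
  have nd: "\<not> k dvd N * k + Suc r" and dv: "(N * k + Suc r) div k = N"
    using r by (auto simp: dvd_eq_mod_eq_0 simp flip: add_Suc_right)
  {
    fix p assume p: "p \<in> ?L"
    show "p \<in> ?R"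
    proof (cases "N * k + Suc r \<in> set p")
      case False
      then have "\<forall>b\<in>set p. b \<le> N * k + r"
        using p unfolding DS_le_def by (metis (no_types, lifting) add_Suc_right le_Suc_eq mem_Collect_eq)
      then show ?thesis
        using p by (simp add: DS_le_def)
    next
      case True
      with p obtain p' where pp: "p = (N * k + Suc r) # p'"
        by (cases p) (auto simp: DS_le_def DS_Cons_iff[OF k] dest: leD)
      \<comment> \<open>A part strictly between N k and the head would be a second non-multiple with
        quotient N.\<close>
      have "b \<le> N * k" if "b \<in> set p'" for b
      proof (rule ccontr)
        assume b: "\<not> b \<le> N * k"
        have "b < N * k + Suc r" using p that by (auto simp: pp DS_le_def DS_Cons_iff[OF k])
        then have c: "b = N * k + (b - N * k)" "0 < b - N * k" "b - N * k < k"
          using b r by linarith+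
        then have "(b - N * k) mod k = b - N * k" "(b - N * k) div k = 0"
          by simp_all
        then have "b div k = N" "\<not> k dvd b"
          using c k by (metis add_0_right div_mult_self3 not_one_le_zero add.commute,
              metis dvd_eq_mod_eq_0 mod_mult_self3 not_gr_zero)
        then show False
          using p that nd dv by (auto simp: pp DS_le_def DS_Cons_iff[OF k])
      qed
      then show ?thesis
        using p by (auto simp: pp DS_le_def DS_Cons_iff[OF k])
    qed
  next
    fix p assume "p \<in> ?R"
    then show "p \<in> ?L"
    proof
      assume "p \<in> Cons (N * k + Suc r) ` DS_le k (N * k)"
      then obtain p' where p': "p = (N * k + Suc r) # p'" "p' \<in> DS k" "\<And>b. b \<in> set p' \<Longrightarrow> b \<le> N * k"
        by (auto simp: DS_le_def)
      have "k dvd b" if "b \<in> set p'" "b div k = N" for b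
      proof -
        have "b = N * k"
          using p'(3)[OF that(1)] div_times_less_eq_dividend[of b k] that(2) by simp
        then show ?thesis by simp
      qed
      moreover have "b < N * k + Suc r" "b \<le> N * k + Suc r" if "b \<in> set p'" for b
        using p'(3)[OF that] by linarith+
      ultimately show ?thesis
        using p' dv by (auto simp: DS_le_def DS_Cons_iff[OF k])
    qed (use DS_le_mono[of "N * k + r" "N * k + Suc r"] in auto)
  }
qed

text \<open>A multiple of k conflicts with no other part, so only strict decrease restricts the
  parts after it.\<close>

lemma DS_le_Suc_multiple:
  assumes k: "k \<ge> 1"
  shows "DS_le k (Suc N * k) = DS_le k (N * k + (k - 1)) \<union>
     Cons (Suc N * k) ` DS_le k (N * k + (k - 1))" (is "?L = ?R")
proof (intro equalityI subsetI)
  have less: "b < Suc N * k \<longleftrightarrow> b \<le> N * k + (k - 1)" for b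
    using k by (cases k) auto
  {
    fix p assume p: "p \<in> ?L"
    show "p \<in> ?R"
    proof (cases "Suc N * k \<in> set p")
      case False
      then have "\<forall>b\<in>set p. b < Suc N * k"
        using p by (auto simp: DS_le_def simp del: mult_Suc intro!: le_neq_implies_less)
      then show ?thesis
        using p unfolding less DS_le_def by blast
    next
      case True
      with p obtain p' where "p = (Suc N * k) # p'"
        by (cases p) (auto simp: DS_le_def DS_Cons_iff[OF k] simp del: mult_Suc dest: leD)
      then show ?thesis
        using p by (auto simp: DS_le_def DS_Cons_iff[OF k] less simp del: mult_Suc)
    qed
  next
    fix p assume "p \<in> ?R"
    then show "p \<in> ?L"
      using assms less[THEN iffD2, THEN less_imp_le]
      by (auto simp: DS_le_def DS_Cons_iff[OF k] less simp del: mult_Suc)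
  }
qed

section \<open>Weights of partitions and the block recurrences for their sums\<close>

definition weight ::
    "nat \<Rightarrow> complex \<Rightarrow> complex \<Rightarrow> (nat \<Rightarrow> complex) \<Rightarrow> (nat \<Rightarrow> complex) \<Rightarrow> nat list \<Rightarrow> complex" where
  "weight k x y u v p = x ^ sum_list (odd_indexed p) * y ^ sum_list (even_indexed p) *
      (\<Prod>l=1..k-1. u l ^ count_residue k l (odd_indexed p) * v l ^ count_residue k l (even_indexed p))"

lemma odd_indexed_Cons: "odd_indexed (n # p) = n # even_indexed p"
  by (simp add: odd_indexed_def even_indexed_def nths_Cons)

lemma even_indexed_Cons: "even_indexed (n # p) = odd_indexed p"
  by (simp add: odd_indexed_def even_indexed_def nths_Cons)

lemma weight_Nil [simp]: "weight k x y u v [] = 1"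
  by (simp add: weight_def odd_indexed_def even_indexed_def count_residue_def)

lemma weight_Cons:
  "weight k x y u v (n # p) =
     x ^ n * (\<Prod>l=1..k-1. if n mod k = l mod k then u l else 1) * weight k y x v u p"
proof -
  have "(\<Prod>l=1..k-1. u l ^ count_residue k l (n # even_indexed p) * v l ^ count_residue k l (odd_indexed p))
      = (\<Prod>l=1..k-1. (if n mod k = l mod k then u l else 1) *
          (v l ^ count_residue k l (odd_indexed p) * u l ^ count_residue k l (even_indexed p)))"
    by (intro prod.cong) (auto simp: count_residue_def)
  also have "\<dots> = (\<Prod>l=1..k-1. if n mod k = l mod k then u l else 1) *
      (\<Prod>l=1..k-1. v l ^ count_residue k l (odd_indexed p) * u l ^ count_residue k l (even_indexed p))"
    by (rule prod.distrib)
  finally show ?thesis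
    by (simp add: weight_def odd_indexed_Cons even_indexed_Cons power_add)
qed

lemma weight_Cons_residue:
  assumes "1 \<le> l" "l \<le> k - 1"
  shows "weight k x y u v ((N * k + l) # p) = (x ^ k) ^ N * (u l * x ^ l) * weight k y x v u p"
proof -
  have "(\<Prod>i=1..k-1. if (N * k + l) mod k = i mod k then u i else 1) =
      (\<Prod>i=1..k-1. if i = l then u i else 1)"
    using assms by (intro prod.cong) auto
  also have "\<dots> = u l"
    using assms by simp
  finally show ?thesis
    by (simp add: weight_Cons power_add power_mult[symmetric] mult.commute[of N])
qed

lemma weight_Cons_multiple:
  "weight k x y u v ((N * k) # p) = (x ^ k) ^ N * weight k y x v u p"
proof -
  have "(\<Prod>i=1..k-1. if (N * k) mod k = i mod k then u i else 1) = (\<Prod>i=1..k-1. 1)"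
    by (intro prod.cong) (auto dest: dvd_imp_le)
  then show ?thesis
    by (simp only: weight_Cons prod.neutral_const power_mult[symmetric] mult.commute[of N])
      simp
qed

definition weight_sum ::
    "nat \<Rightarrow> complex \<Rightarrow> complex \<Rightarrow> (nat \<Rightarrow> complex) \<Rightarrow> (nat \<Rightarrow> complex) \<Rightarrow> nat \<Rightarrow> complex" where
  "weight_sum k x y u v M = (\<Sum>p\<in>DS_le k M. weight k x y u v p)"

text \<open>Transfers a decomposition by the largest part from sets to sums; the union is disjoint
  because n exceeds every part of the lists in \<open>DS_le k M'\<close>.\<close>

lemma weight_sum_union_Cons:
  assumes "DS_le k M = DS_le k M' \<union> Cons n ` DS_le k M''" "M' < n"
    and "\<And>p. weight k x y u v (n # p) = c * weight k y x v u p"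
  shows "weight_sum k x y u v M = weight_sum k x y u v M' + c * weight_sum k y x v u M''"
proof -
  have "DS_le k M' \<inter> Cons n ` DS_le k M'' = {}"
    using assms(2) by (auto simp: DS_le_def)
  then show ?thesis
    unfolding weight_sum_def assms(1)
    by (simp add: sum.union_disjoint finite_DS_le sum.reindex assms(3) sum_distrib_left)
qed

text \<open>Each possible non-multiple of the block is followed by parts at most N k, so all of them
  multiply the same mirror sum. Hence the variables u l enter linearly.\<close>

lemma weight_sum_residues:
  assumes "k \<ge> 1" "r \<le> k - 1"
  shows "weight_sum k x y u v (N * k + r) = weight_sum k x y u v (N * k) +
     (x ^ k) ^ N * (\<Sum>l=1..r. u l * x ^ l) * weight_sum k y x v u (N * k)"
  using assms(2)
proof (induction r)
  case (Suc r)
  have "weight_sum k x y u v (N * k + Suc r) = weight_sum k x y u v (N * k + r) +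
      (x ^ k) ^ N * (u (Suc r) * x ^ Suc r) * weight_sum k y x v u (N * k)"
    using Suc.prems
    by (intro weight_sum_union_Cons[OF DS_le_Suc_residue] weight_Cons_residue assms) auto
  then show ?case
    using Suc by (simp add: algebra_simps)
qed simp

lemma weight_sum_multiple:
  assumes "k \<ge> 1"
  shows "weight_sum k x y u v (Suc N * k) = weight_sum k x y u v (N * k + (k - 1)) +
     (x ^ k) ^ Suc N * weight_sum k y x v u (N * k + (k - 1))"
  using assms
  by (intro weight_sum_union_Cons[OF DS_le_Suc_multiple] weight_Cons_multiple) auto

subsection \<open>The generating function\<close>

theorem weight_sum_eq_rogers_szego:
  assumes k: "k \<ge> 1" and "norm (x * y) < 1"
  shows "weight_sum k x y u v (N * k) = rogers_szego N (- (\<Sum>l=1..k-1. u l * x ^ l))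
     (- (\<Sum>l=1..k-1. v l * y ^ l)) (x ^ k) (x ^ k * y ^ k)"
  using assms(2)
proof (induction N arbitrary: x y u v)
  case 0
  show ?case
    by (simp add: weight_sum_def DS_le_0)
next
  case (Suc N)
  have xy: "norm (x ^ k * y ^ k) < 1"
    using Suc.prems k unfolding power_mult_distrib[symmetric] norm_power
    by (simp add: power_less_one_iff)
  \<comment> \<open>The hypothesis is symmetric in x and y, so the induction hypothesis also covers
    the mirror sum Q.\<close>
  have yx: "norm (y * x) < 1"
    using Suc.prems by (simp add: mult.commute)
  define P Q A B where "P = weight_sum k x y u v (N * k)" and "Q = weight_sum k y x v u (N * k)"
    and "A = (\<Sum>l=1..k-1. u l * x ^ l)" and "B = (\<Sum>l=1..k-1. v l * y ^ l)"
  have P: "P = rogers_szego N (- A) (- B) (x ^ k) (x ^ k * y ^ k)"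
    unfolding P_def A_def B_def by (rule Suc.IH[OF Suc.prems])
  have Q: "Q = rogers_szego N (- B) (- A) (y ^ k) (x ^ k * y ^ k)"
    unfolding Q_def A_def B_def Suc.IH[OF yx] by (simp only: mult.commute)
  \<comment> \<open>The two brackets are the sum and the mirror sum after the non-multiples of the
    block; the multiple (N + 1) k then couples them. The A B terms cancel no part of this: only the
    bracketed products involving P and Q occur.\<close>
  have "weight_sum k x y u v (Suc N * k) =
      (P + (x ^ k) ^ N * A * Q) + (x ^ k) ^ Suc N * (Q + (y ^ k) ^ N * B * P)"
    unfolding weight_sum_multiple[OF k] weight_sum_residues[OF k order_refl]
      P_def Q_def A_def B_def ..
  also have "\<dots> = (1 - (- B) * x ^ k * (x ^ k * y ^ k) ^ N) * P + (x ^ k - (- A)) * ((x ^ k) ^ N * Q)"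
    unfolding power_mult_distrib[of "x ^ k" "y ^ k"] by (simp add: algebra_simps)
  also have "\<dots> = rogers_szego (Suc N) (- A) (- B) (x ^ k) (x ^ k * y ^ k)"
    unfolding rogers_szego_Suc[OF xy] P Q ..
  finally show ?case
    unfolding A_def B_def .
qed

lemma weight_sum_tendsto:
  assumes k: "k \<ge> 1" and "norm x < 1" "norm (x * y) < 1"
  shows "(\<lambda>N. weight_sum k x y u v (N * k)) \<longlonglongrightarrow>
    qpochhammer_inf [- (\<Sum>l=1..k-1. u l * x ^ l), - (x ^ k) * (\<Sum>l=1..k-1. v l * y ^ l)] (x ^ k * y ^ k)
      / qpochhammer_inf [x ^ k] (x ^ k * y ^ k)"
proof -
  have "norm (x ^ k * y ^ k) < 1" "norm (x ^ k) < 1"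
    using assms unfolding power_mult_distrib[symmetric] norm_power
    by (simp_all add: power_less_one_iff)
  from rogers_szego_tendsto[OF this, of "- (\<Sum>l=1..k-1. u l * x ^ l)" "- (\<Sum>l=1..k-1. v l * y ^ l)"]
  show ?thesis
    unfolding weight_sum_eq_rogers_szego[OF k assms(3)] by (simp add: mult.commute)
qed

section \<open>Absolute convergence and passage to the sum over all partitions\<close>

lemma norm_weight:
  "of_real (norm (weight k x y u v p)) =
     weight k (of_real (norm x)) (of_real (norm y)) (\<lambda>l. of_real (norm (u l))) (\<lambda>l. of_real (norm (v l))) p"
  by (simp add: weight_def norm_mult norm_power prod_norm[symmetric])

text \<open>Finitely many partitions have a common bound N0 on their parts, and N0 <= N k whenever N
  >= N0, as k >= 1. Limits along finite subsets can thus be read off from the bounded sums.\<close>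

lemma filterlim_DS_le:
  assumes "k \<ge> 1"
  shows "filterlim (\<lambda>N. DS_le k (N * k)) (finite_subsets_at_top (DS k)) sequentially"
  unfolding filterlim_finite_subsets_at_top
proof (intro allI impI)
  fix F assume F: "finite F \<and> F \<subseteq> DS k"
  then have fin: "finite (\<Union> (set ` F))"
    by auto
  \<comment> \<open>Inserting 0 keeps the maximum meaningful when there are no parts at all.\<close>
  define N0 where "N0 = Max (insert 0 (\<Union> (set ` F)))"
  have "F \<subseteq> DS_le k (N * k)" if "N \<ge> N0" for N
  proof
    fix p assume p: "p \<in> F"
    have "n \<le> N * k" if "n \<in> set p" for n
    proof -
      have "n \<le> N0"
        unfolding N0_def using p that fin by (intro Max_ge) auto
      also have "N0 \<le> N * k"
        using \<open>N \<ge> N0\<close> mult_le_mono[OF \<open>N \<ge> N0\<close> assms] by simp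
      finally show ?thesis .
    qed
    then show "p \<in> DS_le k (N * k)"
      using F p by (auto simp: DS_le_def)
  qed
  then show "\<forall>\<^sub>F N in sequentially. finite (DS_le k (N * k)) \<and> F \<subseteq> DS_le k (N * k) \<and> DS_le k (N * k) \<subseteq> DS k"
    using finite_DS_le DS_le_subset by (auto simp: eventually_sequentially)
qed

text \<open>A weight is a monomial, so its norm is the weight at the norms of the variables. The
  sums of norms over bounded partitions are therefore again values of \<open>weight_sum\<close>,
  convergent and hence bounded.\<close>

lemma abs_summable_weight:
  assumes k: "k \<ge> 1" and x: "norm x < 1" and xy: "norm (x * y) < 1"
  shows "(\<lambda>p. norm (weight k x y u v p)) summable_on DS k"
proof -
  define W where "W = weight_sum k (of_real (norm x)) (of_real (norm y))
    (\<lambda>l. of_real (norm (u l))) (\<lambda>l. of_real (norm (v l)))"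
  have "norm (complex_of_real (norm x)) < 1" "norm (complex_of_real (norm x) * of_real (norm y)) < 1"
    using x xy by (simp_all add: norm_mult)
  from convergent_imp_Bseq[OF convergentI[OF weight_sum_tendsto[OF k this]]]
  obtain K where K: "\<And>N. norm (W (N * k)) \<le> K"
    unfolding Bseq_def W_def by blast
  have bound: "(\<Sum>p\<in>DS_le k (N * k). norm (weight k x y u v p)) \<le> K" for N
  proof -
    have "W (N * k) = of_real (\<Sum>p\<in>DS_le k (N * k). norm (weight k x y u v p))"
      unfolding W_def weight_sum_def of_real_sum norm_weight ..
    then show ?thesis
      using K[of N] by (simp only: norm_of_real)
  qed
  show ?thesis
  proof (rule nonneg_bdd_above_summable_on)
    show "bdd_above (sum (\<lambda>p. norm (weight k x y u v p)) ` {F. F \<subseteq> DS k \<and> finite F})"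
    proof (rule bdd_aboveI2)
      fix F assume "F \<in> {F. F \<subseteq> DS k \<and> finite F}"
      then have "\<forall>\<^sub>F N in sequentially. F \<subseteq> DS_le k (N * k)"
        using filterlim_DS_le[OF k] unfolding filterlim_finite_subsets_at_top
        by (simp add: eventually_conj_iff)
      then obtain N where "F \<subseteq> DS_le k (N * k)"
        using eventually_happens' sequentially_bot by blast
      then have "(\<Sum>p\<in>F. norm (weight k x y u v p)) \<le> (\<Sum>p\<in>DS_le k (N * k). norm (weight k x y u v p))"
        by (intro sum_mono2 finite_DS_le) auto
      then show "(\<Sum>p\<in>F. norm (weight k x y u v p)) \<le> K"
        using bound[of N] by linarith
    qed
  qed simp
qed

theorem theorem2p6:
  fixes k :: nat and x y :: complex and u v :: "nat \<Rightarrow> complex"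
  assumes "k \<ge> 1" and "norm x < 1" and "norm (x * y) < 1"
  shows "((\<lambda>p. x ^ sum_list (odd_indexed p) * y ^ sum_list (even_indexed p) *
              (\<Prod>l=1..k-1. u l ^ count_residue k l (odd_indexed p) *
                           v l ^ count_residue k l (even_indexed p)))
          has_sum
            (qpochhammer_inf [- (\<Sum>l=1..k-1. u l * x ^ l), - (x ^ k) * (\<Sum>l=1..k-1. v l * y ^ l)]
                (x ^ k * y ^ k)
             / qpochhammer_inf [x ^ k] (x ^ k * y ^ k))) (DS k)"
proof -
  obtain s where s: "(weight k x y u v has_sum s) (DS k)"
    using abs_summable_summable[OF abs_summable_weight[OF assms]] by (auto simp: summable_on_def)
  \<comment> \<open>The unconditional sum s is also the limit along the exhaustion by bounded
    partitions, whose limit is already known.\<close>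
  have "(\<lambda>N. weight_sum k x y u v (N * k)) \<longlonglongrightarrow> s"
    using filterlim_compose[OF s[unfolded has_sum_def] filterlim_DS_le[OF assms(1)]]
    unfolding weight_sum_def .
  from LIMSEQ_unique[OF weight_sum_tendsto[OF assms] this] s show ?thesis
    unfolding weight_def by simp
qed

end
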